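(* Let $\mathcal A=(Q,\Sigma,\delta,s,F)$ be a DFA satisfying the standing assumptions below. Then for any $u,v\in Q$ with $u\neq v$: $u<_{\mathcal A}v$ if and only if $\sup I_u\le\inf I_v$.
   Context: A DFA is $\mathcal A=(Q,\Sigma,\delta,s,F)$ with finite state set $Q$, finite totally ordered alphabet $\Sigma$, (partial) transition function $\delta$, initial state $s$, final states $F$; $\delta$ extended to words as usual. Standing assumptions: $s$ has no incoming transitions; every state is reachable from $s$; all transitions entering a given state carry the same label. $I_q=\{\alpha\in\Sigma^*:\delta(s,\alpha)=q\}$. Strings may be finite or left-infinite $\omega$-strings. Co-lex order on $\Sigma^*\cup\Sigma^\omega$: $\epsilon<\alpha$ for nonempty $\alpha$; for $\alpha=\alpha'a$, $\beta=\beta'b$ with $a,b\in\Sigma$, $\alpha<\beta$ iff $a<b$, or $a=b$ and $\alpha'<\beta'$. $\inf I_u$, $\sup I_u$ are the greatest lower bound and least upper bound of $I_u$ in $(\Sigma^*\cup\Sigma^\omega,\le)$. The relation $<_{\mathcal A}$ on $Q$ is defined by $u<_{\mathcal A}v$ iff $\alpha<\beta$ for all $\alpha\in I_u$ and all $\beta\in I_v$. *)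

theory Defs
  imports "HOL-Library.Lub_Glb"
begin

text \<open>
  Finite strings and left-infinite strings.  In \<open>Omega f\<close> the letter \<open>f i\<close> stands at
  position \<open>i\<close> counted from the right end, so \<open>f 0\<close> is the last letter.
\<close>

datatype 'a ostring = Fin "'a list" | Omega "nat \<Rightarrow> 'a"

primrec snoc :: "'a ostring \<Rightarrow> 'a \<Rightarrow> 'a ostring" where
  "snoc (Fin w) a = Fin (w @ [a])"
| "snoc (Omega f) a = Omega (case_nat a f)"

definition strings_over :: "'a set \<Rightarrow> 'a ostring set" where
  "strings_over \<Sigma> = {Fin w | w. set w \<subseteq> \<Sigma>} \<union> {Omega f | f. range f \<subseteq> \<Sigma>}"

text \<open>
  The recursive clauses of the co-lex order are not well-founded on left-infinite strings.  They
  are read inductively; the greatest solution would relate every left-infinite string to itself.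
\<close>

inductive colex_less :: "'a::linorder ostring \<Rightarrow> 'a ostring \<Rightarrow> bool" where
  eps: "\<alpha> \<noteq> Fin [] \<Longrightarrow> colex_less (Fin []) \<alpha>"
| last: "a < b \<Longrightarrow> colex_less (snoc \<alpha> a) (snoc \<beta> b)"
| same: "colex_less \<alpha> \<beta> \<Longrightarrow> colex_less (snoc \<alpha> a) (snoc \<beta> a)"

lemma snoc_eq_iff [simp]: "snoc \<alpha> a = snoc \<beta> b \<longleftrightarrow> \<alpha> = \<beta> \<and> a = b"
proof -
  have "case_nat a f = case_nat b g \<longleftrightarrow> a = b \<and> f = g" for f g :: "nat \<Rightarrow> 'a"
    by (auto simp: fun_eq_iff split: nat.splits)
  then show ?thesis by (cases \<alpha>; cases \<beta>) auto
qed

lemma snoc_neq_eps [simp]: "snoc \<alpha> a \<noteq> Fin []" "Fin [] \<noteq> snoc \<alpha> a"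
  by (cases \<alpha>; simp)+

lemma ostring_cases_snoc:
  obtains "\<alpha> = Fin []" | \<alpha>' a where "\<alpha> = snoc \<alpha>' a"
proof (cases \<alpha>)
  case (Fin w)
  then show ?thesis using that(1) that(2)[of "Fin (butlast w)" "last w"] by (cases "w = []") auto
next
  case (Omega f)
  have "case_nat (f 0) (\<lambda>i. f (Suc i)) = f" by (auto simp: fun_eq_iff split: nat.splits)
  then show ?thesis using that(2)[of "Omega (\<lambda>i. f (Suc i))" "f 0"] Omega by simp
qed

lemma colex_less_eps_right [simp]: "\<not> colex_less \<alpha> (Fin [])"
  by (auto elim: colex_less.cases)

lemma colex_less_eps_left [simp]: "colex_less (Fin []) \<alpha> \<longleftrightarrow> \<alpha> \<noteq> Fin []"
  by (auto intro: colex_less.eps)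

lemma colex_less_snoc [simp]:
  "colex_less (snoc \<alpha> a) (snoc \<beta> b) \<longleftrightarrow> a < b \<or> a = b \<and> colex_less \<alpha> \<beta>"
  by (auto intro: colex_less.intros elim: colex_less.cases)

lemma colex_less_irrefl: "\<not> colex_less \<alpha> \<alpha>"
proof -
  have "colex_less \<alpha> \<beta> \<Longrightarrow> \<alpha> \<noteq> \<beta>" for \<alpha> \<beta> :: "'a ostring"
    by (induction rule: colex_less.induct) auto
  then show ?thesis by blast
qed

lemma colex_less_trans: "colex_less \<alpha> \<beta> \<Longrightarrow> colex_less \<beta> \<gamma> \<Longrightarrow> colex_less \<alpha> \<gamma>"
proof (induction arbitrary: \<gamma> rule: colex_less.induct)
  case (eps \<alpha>)
  then show ?case by auto
next
  case (last a b \<alpha> \<beta>)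
  then show ?case by (cases \<gamma> rule: ostring_cases_snoc) auto
next
  case (same \<alpha> \<beta> a)
  then show ?case by (cases \<gamma> rule: ostring_cases_snoc) auto
qed

lemma colex_less_total: "\<alpha> = \<beta> \<or> colex_less \<alpha> \<beta> \<or> colex_less \<beta> \<alpha>"
proof -
  have fin: "Fin w = \<gamma> \<or> colex_less (Fin w) \<gamma> \<or> colex_less \<gamma> (Fin w)" for w and \<gamma> :: "'a ostring"
  proof (induction w arbitrary: \<gamma> rule: rev_induct)
    case Nil
    then show ?case by auto
  next
    case (snoc a w)
    have w: "Fin (w @ [a]) = Defs.snoc (Fin w) a" by simp
    show ?case
      unfolding w using snoc.IH by (cases \<gamma> rule: ostring_cases_snoc) (auto simp del: snoc.simps)
  qed
  have omega: "f n \<noteq> g n \<Longrightarrow> colex_less (Omega f) (Omega g) \<or> colex_less (Omega g) (Omega f)"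
    for f g :: "nat \<Rightarrow> 'a" and n
  proof (induction n arbitrary: f g)
    case (0 f g)
    have e: "Omega h = snoc (Omega (\<lambda>i. h (Suc i))) (h 0)" for h :: "nat \<Rightarrow> 'a"
      by (auto simp: fun_eq_iff split: nat.splits)
    show ?case using 0 by (subst (1 2 3 4) e) (auto simp del: snoc.simps)
  next
    case (Suc n f g)
    have e: "Omega h = snoc (Omega (\<lambda>i. h (Suc i))) (h 0)" for h :: "nat \<Rightarrow> 'a"
      by (auto simp: fun_eq_iff split: nat.splits)
    show ?case using Suc.IH[of "\<lambda>i. f (Suc i)" "\<lambda>i. g (Suc i)"] Suc.prems
      by (subst (1 2 3 4) e) (auto simp del: snoc.simps)
  qed
  show ?thesis
  proof (cases \<alpha>)
    case (Fin w)
    then show ?thesis using fin by simp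
  next
    case f: (Omega f)
    show ?thesis
    proof (cases \<beta>)
      case (Fin w)
      then show ?thesis using fin by metis
    next
      case (Omega g)
      then show ?thesis using f omega by (metis ext)
    qed
  qed
qed

instantiation ostring :: (linorder) linorder
begin

definition less_ostring :: "'a ostring \<Rightarrow> 'a ostring \<Rightarrow> bool" where
  "less_ostring = colex_less"

definition less_eq_ostring :: "'a ostring \<Rightarrow> 'a ostring \<Rightarrow> bool" where
  "less_eq_ostring \<alpha> \<beta> \<longleftrightarrow> \<alpha> = \<beta> \<or> \<alpha> < \<beta>"

instance
proof
  fix x y z :: "'a ostring"
  show "x < y \<longleftrightarrow> x \<le> y \<and> \<not> y \<le> x"
    unfolding less_eq_ostring_def less_ostring_def
    using colex_less_irrefl colex_less_trans by blast
  show "x \<le> x" by (simp add: less_eq_ostring_def)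
  show "x \<le> y \<Longrightarrow> y \<le> z \<Longrightarrow> x \<le> z"
    unfolding less_eq_ostring_def less_ostring_def using colex_less_trans by blast
  show "x \<le> y \<Longrightarrow> y \<le> x \<Longrightarrow> x = y"
    unfolding less_eq_ostring_def less_ostring_def
    using colex_less_irrefl colex_less_trans by blast
  show "x \<le> y \<or> y \<le> x"
    unfolding less_eq_ostring_def less_ostring_def using colex_less_total by blast
qed

end

definition sup_string :: "'a::linorder set \<Rightarrow> 'a ostring set \<Rightarrow> 'a ostring" where
  "sup_string \<Sigma> A = (THE x. isLub (strings_over \<Sigma>) A x)"

definition inf_string :: "'a::linorder set \<Rightarrow> 'a ostring set \<Rightarrow> 'a ostring" where
  "inf_string \<Sigma> A = (THE x. isGlb (strings_over \<Sigma>) A x)"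

record ('q, 'a) dfa =
  states :: "'q set"
  alphabet :: "'a set"
  trans :: "'q \<Rightarrow> 'a \<Rightarrow> 'q option"
  initial :: 'q
  final :: "'q set"

definition is_dfa :: "('q, 'a::linorder) dfa \<Rightarrow> bool" where
  "is_dfa A \<longleftrightarrow>
     finite (states A) \<and> finite (alphabet A) \<and>
     initial A \<in> states A \<and> final A \<subseteq> states A \<and>
     (\<forall>p\<in>states A. \<forall>a\<in>alphabet A. \<forall>q. trans A p a = Some q \<longrightarrow> q \<in> states A)"

primrec trans_word :: "('q, 'a) dfa \<Rightarrow> 'q \<Rightarrow> 'a list \<Rightarrow> 'q option" where
  "trans_word A q [] = Some q"
| "trans_word A q (a # w) = Option.bind (trans A q a) (\<lambda>p. trans_word A p w)"

definition reaching :: "('q, 'a) dfa \<Rightarrow> 'q \<Rightarrow> 'a ostring set" where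
  "reaching A q = {Fin w | w. set w \<subseteq> alphabet A \<and> trans_word A (initial A) w = Some q}"

definition standing_assumptions :: "('q, 'a) dfa \<Rightarrow> bool" where
  "standing_assumptions A \<longleftrightarrow>
     (\<forall>p\<in>states A. \<forall>a\<in>alphabet A. trans A p a \<noteq> Some (initial A)) \<and>
     (\<forall>q\<in>states A. \<exists>w. set w \<subseteq> alphabet A \<and> trans_word A (initial A) w = Some q) \<and>
     (\<forall>p\<in>states A. \<forall>p'\<in>states A. \<forall>a\<in>alphabet A. \<forall>b\<in>alphabet A. \<forall>q.
        trans A p a = Some q \<longrightarrow> trans A p' b = Some q \<longrightarrow> a = b)"

definition state_less :: "('q, 'a::linorder) dfa \<Rightarrow> 'q \<Rightarrow> 'q \<Rightarrow> bool" where
  "state_less A u v \<longleftrightarrow> (\<forall>\<alpha>\<in>reaching A u. \<forall>\<beta>\<in>reaching A v. \<alpha> < \<beta>)"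

end

theory Submission
  imports Defs
begin

text \<open>
  The point is that sup and inf exist at all: over a finite alphabet the co-lex order is complete.
  A nonempty set of strings either is \<open>{\<epsilon>}\<close> or has a largest last letter \<open>a\<close>, and then its supremum
  is \<open>\<sigma> a\<close>, where \<open>\<sigma>\<close> is the supremum of the strings \<open>\<alpha>\<close> with \<open>\<alpha> a\<close> in the set.  If this reduction
  never terminates, the letters it reads off form a left-infinite string, and that is the supremum.
  Infima are suprema of sets of lower bounds.  Given this, \<open>sup I\<^sub>u \<le> inf I\<^sub>v\<close> says that
  \<open>\<alpha> \<le> \<beta>\<close> for all \<open>\<alpha> \<in> I\<^sub>u\<close> and \<open>\<beta> \<in> I\<^sub>v\<close>, and \<open>\<alpha> = \<beta>\<close> is excluded by determinism.
\<close>

declare snoc.simps [simp del]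

lemma snoc_less_snoc [simp]: "snoc \<alpha> a < snoc \<beta> b \<longleftrightarrow> a < b \<or> a = b \<and> \<alpha> < \<beta>"
  by (simp add: less_ostring_def)

lemma snoc_le_snoc [simp]: "snoc \<alpha> a \<le> snoc \<beta> b \<longleftrightarrow> a < b \<or> a = b \<and> \<alpha> \<le> \<beta>"
  by (auto simp: less_eq_ostring_def)

lemma eps_le [simp]: "Fin [] \<le> \<alpha>"
  by (auto simp: less_eq_ostring_def less_ostring_def)

lemma le_eps_iff [simp]: "\<alpha> \<le> Fin [] \<longleftrightarrow> \<alpha> = Fin []"
  by (auto simp: less_eq_ostring_def less_ostring_def)

lemma eps_in_strings_over [simp]: "Fin [] \<in> strings_over \<Sigma>"
  by (simp add: strings_over_def)

lemma snoc_in_strings_over [simp]: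
  "snoc \<alpha> a \<in> strings_over \<Sigma> \<longleftrightarrow> \<alpha> \<in> strings_over \<Sigma> \<and> a \<in> \<Sigma>"
proof (cases \<alpha>)
  case (Omega f)
  have "range (case_nat a f) = insert a (range f)"
    by (auto simp: image_iff split: nat.splits)
  then show ?thesis
    using Omega by (auto simp: strings_over_def snoc.simps)
qed (auto simp: strings_over_def snoc.simps)

lemma Omega_eq_snoc: "Omega f = snoc (Omega (\<lambda>i. f (Suc i))) (f 0)"
  by (auto simp: snoc.simps fun_eq_iff split: nat.splits)

lemma isLub_iff:
  "isLub S A x \<longleftrightarrow> x \<in> S \<and> (\<forall>\<alpha>\<in>A. \<alpha> \<le> x) \<and> (\<forall>y\<in>S. (\<forall>\<alpha>\<in>A. \<alpha> \<le> y) \<longrightarrow> x \<le> y)"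
  by (auto simp: isLub_def leastP_def isUb_def setle_def setge_def)

lemma isGlb_iff:
  "isGlb S A x \<longleftrightarrow> x \<in> S \<and> (\<forall>\<alpha>\<in>A. x \<le> \<alpha>) \<and> (\<forall>y\<in>S. (\<forall>\<alpha>\<in>A. y \<le> \<alpha>) \<longrightarrow> y \<le> x)"
  by (auto simp: isGlb_def greatestP_def isLb_def setle_def setge_def)

definition max_last :: "'a::linorder ostring set \<Rightarrow> 'a \<Rightarrow> bool" where
  "max_last A a \<longleftrightarrow> (\<exists>\<alpha>. snoc \<alpha> a \<in> A) \<and> (\<forall>\<alpha> b. snoc \<alpha> b \<in> A \<longrightarrow> b \<le> a)"

lemma ex_max_last:
  assumes "finite \<Sigma>" and "A \<subseteq> strings_over \<Sigma>" and "\<alpha> \<in> A" and "\<alpha> \<noteq> Fin []"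
  obtains a where "max_last A a" and "a \<in> \<Sigma>"
proof -
  let ?L = "{b. \<exists>\<beta>. snoc \<beta> b \<in> A}"
  have sub: "?L \<subseteq> \<Sigma>"
    using assms(2) by (auto dest!: subsetD)
  then have fin: "finite ?L"
    using assms(1) by (rule finite_subset)
  have "?L \<noteq> {}"
    using assms(3,4) by (cases \<alpha> rule: ostring_cases_snoc) auto
  then have "Max ?L \<in> ?L"
    using Max_in fin by blast
  moreover have "b \<le> Max ?L" if "snoc \<beta> b \<in> A" for \<beta> b
    using that fin by (auto intro: Max_ge)
  ultimately show thesis
    using that[of "Max ?L"] sub unfolding max_last_def by blast
qed

lemma isLub_snoc:
  assumes "max_last A a" and "a \<in> \<Sigma>" and "isLub (strings_over \<Sigma>) {\<alpha>. snoc \<alpha> a \<in> A} x"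
  shows "isLub (strings_over \<Sigma>) A (snoc x a)"
  unfolding isLub_iff
proof (intro conjI ballI impI)
  show "snoc x a \<in> strings_over \<Sigma>"
    using assms by (simp add: isLub_iff)
next
  fix \<alpha> assume "\<alpha> \<in> A"
  then show "\<alpha> \<le> snoc x a"
    using assms by (cases \<alpha> rule: ostring_cases_snoc) (auto simp: max_last_def isLub_iff order.order_iff_strict[of _ a])
next
  fix y assume y: "y \<in> strings_over \<Sigma>" "\<forall>\<alpha>\<in>A. \<alpha> \<le> y"
  obtain w where w: "snoc w a \<in> A"
    using assms(1) by (auto simp: max_last_def)
  show "snoc x a \<le> y"
  proof (cases y rule: ostring_cases_snoc)
    case 1
    then show ?thesis using w y by fastforce
  next
    case (2 y' b)
    have "snoc w a \<le> snoc y' b"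
      using w y 2 by blast
    then consider "a < b" | "a = b" by auto
    then show ?thesis
    proof cases
      case 2
      then have "\<forall>\<alpha>\<in>{\<alpha>. snoc \<alpha> a \<in> A}. \<alpha> \<le> y'"
        using y \<open>y = snoc y' b\<close> by fastforce
      then show ?thesis
        using assms(3) y \<open>y = snoc y' b\<close> 2 by (simp add: isLub_iff)
    qed (simp add: 2)
  qed
qed

lemma isLub_Omega:
  fixes B :: "nat \<Rightarrow> 'a::linorder ostring set"
  assumes max: "\<And>n. max_last (B n) (a n)" and mem: "\<And>n. a n \<in> \<Sigma>"
    and step: "\<And>n. B (Suc n) = {\<alpha>. snoc \<alpha> (a n) \<in> B n}"
  shows "isLub (strings_over \<Sigma>) (B 0) (Omega a)"
proof -
  define t where "t n = Omega (\<lambda>i. a (n + i))" for n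
  have t: "t n = snoc (t (Suc n)) (a n)" for n
    unfolding t_def by (subst Omega_eq_snoc) simp
  have upper: "colex_less x y \<Longrightarrow> x = t n \<Longrightarrow> y \<notin> B n" for x y n
  proof (induction arbitrary: n rule: colex_less.induct)
    case (eps \<alpha>)
    then show ?case by (simp add: t_def)
  next
    case (last b c \<alpha> \<beta>)
    then have "b = a n" using t[of n] by simp
    then show ?case using last max[of n] by (fastforce simp: max_last_def)
  next
    case (same \<alpha> \<beta> b)
    then have "b = a n" "\<alpha> = t (Suc n)" using t[of n] by simp_all
    then show ?case using same.IH[of "Suc n"] step by auto
  qed
  have least: "colex_less x y \<Longrightarrow> y = t n \<Longrightarrow> \<exists>z\<in>B n. x < z" for x y n
  proof (induction arbitrary: n rule: colex_less.induct)
    case (eps \<alpha>)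
    then show ?case using max[of n] by (auto simp: max_last_def less_ostring_def intro: bexI[rotated])
  next
    case (last b c \<alpha> \<beta>)
    then have "c = a n" using t[of n] by simp
    then show ?case using last max[of n] by (auto simp: max_last_def intro: bexI[rotated])
  next
    case (same \<alpha> \<beta> b)
    then have "b = a n" "\<beta> = t (Suc n)" using t[of n] by simp_all
    then show ?case using same.IH[of "Suc n"] step by (auto intro: bexI[rotated])
  qed
  have "t 0 = Omega a" by (simp add: t_def)
  then show ?thesis
    using mem upper[of _ _ 0] least[of _ _ 0] unfolding isLub_iff less_ostring_def[symmetric]
    by (force simp: strings_over_def not_less[symmetric])
qed

theorem ex_isLub_strings_over:
  fixes A :: "'a::linorder ostring set"
  assumes fin: "finite \<Sigma>" and "A \<subseteq> strings_over \<Sigma>" and "A \<noteq> {}"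
  shows "\<exists>x. isLub (strings_over \<Sigma>) A x"
proof (rule ccontr)
  assume none: "\<nexists>x. isLub (strings_over \<Sigma>) A x"
  define P where "P B \<longleftrightarrow> B \<subseteq> strings_over \<Sigma> \<and> B \<noteq> {} \<and> (\<nexists>x. isLub (strings_over \<Sigma>) B x)"
    for B :: "'a ostring set"
  have next_letter: "\<exists>C. P C \<and> (\<exists>a\<in>\<Sigma>. max_last B a \<and> C = {\<alpha>. snoc \<alpha> a \<in> B})" if PB: "P B" for B
  proof -
    have "B \<noteq> {Fin []}"
      using PB by (auto simp: P_def isLub_iff)
    then obtain \<alpha> where "\<alpha> \<in> B" "\<alpha> \<noteq> Fin []"
      using PB unfolding P_def by blast
    then obtain a where a: "max_last B a" "a \<in> \<Sigma>"
      using ex_max_last[OF fin] PB by (auto simp: P_def)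
    then have "P {\<alpha>. snoc \<alpha> a \<in> B}"
      using PB isLub_snoc[OF a] by (auto simp: P_def max_last_def dest: subsetD)
    with a show ?thesis by blast
  qed
  have "P A" using assms none by (simp add: P_def)
  obtain B where B: "B 0 = A" "\<And>n. \<exists>a\<in>\<Sigma>. max_last (B n) a \<and> B (Suc n) = {\<alpha>. snoc \<alpha> a \<in> B n}"
    using dependent_nat_choice[of "\<lambda>n B. P B \<and> (n = 0 \<longrightarrow> B = A)"
        "\<lambda>n B C. \<exists>a\<in>\<Sigma>. max_last B a \<and> C = {\<alpha>. snoc \<alpha> a \<in> B}"]
      \<open>P A\<close> next_letter by auto
  then obtain a where "\<And>n. a n \<in> \<Sigma> \<and> max_last (B n) (a n) \<and> B (Suc n) = {\<alpha>. snoc \<alpha> (a n) \<in> B n}"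
    by metis
  then show False
    using isLub_Omega[of B a \<Sigma>] none B(1) by blast
qed

theorem ex_isGlb_strings_over:
  assumes "finite \<Sigma>" and "A \<subseteq> strings_over \<Sigma>" and "A \<noteq> {}"
  shows "\<exists>x. isGlb (strings_over \<Sigma>) A x"
proof -
  let ?L = "{y \<in> strings_over \<Sigma>. \<forall>\<alpha>\<in>A. y \<le> \<alpha>}"
  have "Fin [] \<in> ?L" by simp
  then obtain x where "isLub (strings_over \<Sigma>) ?L x"
    using ex_isLub_strings_over[OF assms(1), of ?L] by blast
  then have "isGlb (strings_over \<Sigma>) A x"
    using assms(2) by (auto simp: isLub_iff isGlb_iff)
  then show ?thesis ..
qed

lemma isLub_sup_string:
  assumes "finite \<Sigma>" and "A \<subseteq> strings_over \<Sigma>" and "A \<noteq> {}"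
  shows "isLub (strings_over \<Sigma>) A (sup_string \<Sigma> A)"
  unfolding sup_string_def
  using ex_isLub_strings_over[OF assms] by (metis isLub_unique theI)

lemma isGlb_inf_string:
  assumes "finite \<Sigma>" and "A \<subseteq> strings_over \<Sigma>" and "A \<noteq> {}"
  shows "isGlb (strings_over \<Sigma>) A (inf_string \<Sigma> A)"
  unfolding inf_string_def
proof (rule theI')
  show "\<exists>!x. isGlb (strings_over \<Sigma>) A x"
    using ex_isGlb_strings_over[OF assms] by (auto simp: isGlb_iff intro: order_antisym)
qed

lemma sup_string_le_inf_string_iff:
  assumes "finite \<Sigma>" and "A \<subseteq> strings_over \<Sigma>" "A \<noteq> {}" and "B \<subseteq> strings_over \<Sigma>" "B \<noteq> {}"
  shows "sup_string \<Sigma> A \<le> inf_string \<Sigma> B \<longleftrightarrow> (\<forall>\<alpha>\<in>A. \<forall>\<beta>\<in>B. \<alpha> \<le> \<beta>)"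
  using isLub_sup_string[OF assms(1-3)] isGlb_inf_string[OF assms(1,4,5)] assms(2,4)
  unfolding isLub_iff isGlb_iff by (meson order_trans subsetD)

theorem theorem10:
  fixes A :: "('q, 'a::linorder) dfa" and u v :: 'q
  assumes "is_dfa A" and "standing_assumptions A"
    and "u \<in> states A" and "v \<in> states A" and "u \<noteq> v"
  shows "state_less A u v \<longleftrightarrow>
    sup_string (alphabet A) (reaching A u) \<le> inf_string (alphabet A) (reaching A v)"
proof -
  have sub: "reaching A q \<subseteq> strings_over (alphabet A)" for q
    by (auto simp: reaching_def strings_over_def)
  have ne: "reaching A q \<noteq> {}" if "q \<in> states A" for q
    using assms(2) that by (auto simp: standing_assumptions_def reaching_def)
  have "reaching A u \<inter> reaching A v = {}"
    using assms(5) by (auto simp: reaching_def)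
  then have "state_less A u v \<longleftrightarrow> (\<forall>\<alpha>\<in>reaching A u. \<forall>\<beta>\<in>reaching A v. \<alpha> \<le> \<beta>)"
    unfolding state_less_def by (auto simp: le_less)
  also have "\<dots> \<longleftrightarrow>
      sup_string (alphabet A) (reaching A u) \<le> inf_string (alphabet A) (reaching A v)"
    using assms by (subst sup_string_le_inf_string_iff) (auto simp: sub ne is_dfa_def)
  finally show ?thesis .
qed

end
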